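(* Let $\Pi$ be a logic program over a vocabulary $\sigma$, let $\iota\subseteq\sigma$ be a vocabulary with $hd(\Pi)\cap\iota=\emptyset$, and let $X$ be a set of atoms over $\sigma$. Then $X$ is an input answer set of $\Pi$ relative to $\iota$ if and only if there is a model $X\cup X_i$, with $X_i\subseteq\sigma_i^{R(\Pi,\iota)}$, of the constraint formula $\langle IComp(\Pi,\iota)\wedge R(\Pi,\iota),\ \mathcal{B}_{R(\Pi,\iota)},\ \gamma^{R(\Pi,\iota)}\rangle$ over the vocabulary $\sigma\cup\sigma_i^{R(\Pi,\iota)}$ (with regular atoms $\sigma$ and irregular atoms $\sigma_i^{R(\Pi,\iota)}$).
   Context: Logic programs. A program $\Pi$ over a vocabulary (set of atoms) $\sigma$ is a set of rules $a\leftarrow b_1,\ldots,b_\ell,\ not\ b_{\ell+1},\ldots,\ not\ b_m,\ not\ not\ b_{m+1},\ldots,\ not\ not\ b_n$ ($a\in\sigma$ or $\bot$, $b_i\in\sigma$), identified with $B\rightarrow a$ where $B=b_1\wedge\cdots\wedge b_\ell\wedge\neg b_{\ell+1}\wedge\cdots\wedge\neg b_m\wedge\neg\neg b_{m+1}\wedge\cdots\wedge\neg\neg b_n$ is the body, $B^+=\{b_1,\dots,b_\ell\}$ its positive part and the rest its negative part. Sets of atoms are identified with assignments making exactly their atoms true. $hd(\Pi)$: heads that are atoms; $Bodies(\Pi,a)$: bodies of rules with head $a$; $At(F)$: atoms of formula $F$. Reduct $\Pi^X$: delete rules whose negative part $X$ does not satisfy, replace the rest by $a\leftarrow b_1,..,b_\ell$;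 $X$ is an answer set if it is a minimal set satisfying $\Pi^X$. For $\iota\subseteq\sigma$ with $hd(\Pi)\cap\iota=\emptyset$: $X\subseteq\sigma$ is an input answer set of $\Pi$ relative to $\iota$ if it is an answer set of $\Pi\cup\{a.\mid a\in X\cap\iota\}$; $IComp(\Pi,\iota)$ is the conjunction of the rules of $\Pi$ and the implications $a\rightarrow\bigvee_{B\in Bodies(\Pi,a)}B$ for all $a\in\sigma\setminus\iota$ (empty disjunction $=\bot$). Integer linear constraints. The integer lexicon over a set $V$ of variables has domain $\mathbb{Z}$, binary predicate symbols $<,>,\leq,\geq,=,\neq$ and binary function symbols $+,\times$ with their usual meanings over $\mathbb{Z}$. An integer linear constraint is $a_1x_1+\cdots+a_nx_n\bowtie k$ with $a_j,k\in\mathbb{Z}$, $x_j\in V$, $\bowtie\in\{<,>,\leq,\geq,=,\neq\}$; a valuation $\nu:V\to\mathbb{Z}$ satisfies it if the arithmetic relation holds, and satisfies its negation $\neg c$ if $c$ fails. A GCSP is a finite set of such constraints (and negations); a solution is a valuation satisfying all of them. The formula $R(\Pi,\iota)$. For every atom $a$ let $lr_a$ be an integer variable, and for atoms $a,b$ let $|lr_a-1\geq lr_b|$ be a fresh propositional atom not in $\sigma$. $R(\Pi,\iota)$ is the conjunction, over all $a\in\sigma\setminus\iota$, of the formulas $a\rightarrow\bigvee_{a\leftarrow B\in\Pi,\ B^+\setminus\iota\neq\emptyset}\big(B\wedge\bigwedge_{b\in B^+\setminus\iota}|lr_a-1\geq lr_b|\big)\ \vee\ \bigvee_{a\leftarrow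 B\in\Pi,\ B^+\setminus\iota=\emptyset}B$. $\sigma_i^{R(\Pi,\iota)}$ is the set of atoms $|lr_a-1\geq lr_b|$ occurring in $R(\Pi,\iota)$; $\Sigma^{R(\Pi,\iota)}$ is the set of variables occurring in them; $\gamma^{R(\Pi,\iota)}$ maps $|lr_a-1\geq lr_b|$ to the integer linear constraint $lr_a-1\geq lr_b$ (i.e. $lr_a-lr_b\geq 1$); $\mathcal{B}_{R(\Pi,\iota)}$ is the set of all integer linear constraints over the integer lexicon with variables $\Sigma^{R(\Pi,\iota)}$. Constraint formulas. For disjoint vocabularies $\sigma_r$ (regular) and $\sigma_i$ (irregular), a constraint formula $\langle F,\mathcal{B},\gamma\rangle$ over $\sigma_r\cup\sigma_i$ consists of a propositional formula $F$, a set $\mathcal{B}$ of constraints over a lexicon, and an injective $\gamma:\sigma_i\to\mathcal{B}$; $Y\subseteq At(F)$ is a model if $Y$ satisfies $F$ and the GCSP $\{\gamma(a)\mid a\in Y\cap\sigma_i\}\cup\{\neg\gamma(a)\mid a\in(At(F)\cap\sigma_i)\setminus Y\}$ has a solution.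
   Formalization: Vocabularies and programs are taken finite. Models are sets of atoms of σ∪σ_i rather than subsets of At(F): with the latter the claim fails for empty Π and σ=ι=X={p}. The version with subsets of At(F) is also proved whenever X⊆At(F). *)

theory Defs
  imports Main
begin

section \<open>Propositional formulas\<close>

datatype (atoms: 'a) form =
    Bot
  | Top
  | Atm 'a
  | Neg "'a form"
  | And "'a form" "'a form"
  | Or "'a form" "'a form"
  | Imp "'a form" "'a form"

primrec sat :: "'a set \<Rightarrow> 'a form \<Rightarrow> bool" where
  "sat X Bot \<longleftrightarrow> False"
| "sat X Top \<longleftrightarrow> True"
| "sat X (Atm a) \<longleftrightarrow> a \<in> X"
| "sat X (Neg F) \<longleftrightarrow> \<not> sat X F"
| "sat X (And F G) \<longleftrightarrow> sat X F \<and> sat X G"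
| "sat X (Or F G) \<longleftrightarrow> sat X F \<or> sat X G"
| "sat X (Imp F G) \<longleftrightarrow> (sat X F \<longrightarrow> sat X G)"

text \<open>Conjunctions and disjunctions of finite sets of formulas are taken in an arbitrary order;
  on infinite sets the two functions below have no meaning.\<close>

definition enum_set :: "'b set \<Rightarrow> 'b list" where
  "enum_set S = (SOME xs. set xs = S \<and> distinct xs)"

definition BigAnd :: "'a form set \<Rightarrow> 'a form" where
  "BigAnd S = foldr And (enum_set S) Top"

definition BigOr :: "'a form set \<Rightarrow> 'a form" where
  "BigOr S = foldr Or (enum_set S) Bot"

lemma set_enum_set: "finite S \<Longrightarrow> set (enum_set S) = S"
  unfolding enum_set_def by (rule someI2_ex) (use finite_distinct_list in auto)

lemma sat_BigAnd: "finite S \<Longrightarrow> sat X (BigAnd S) \<longleftrightarrow> (\<forall>F\<in>S. sat X F)"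
proof -
  have "sat X (foldr And xs Top) \<longleftrightarrow> (\<forall>F\<in>set xs. sat X F)" for xs
    by (induction xs) auto
  then show "finite S \<Longrightarrow> ?thesis" by (simp add: BigAnd_def set_enum_set)
qed

lemma sat_BigOr: "finite S \<Longrightarrow> sat X (BigOr S) \<longleftrightarrow> (\<exists>F\<in>S. sat X F)"
proof -
  have "sat X (foldr Or xs Bot) \<longleftrightarrow> (\<exists>F\<in>set xs. sat X F)" for xs
    by (induction xs) auto
  then show "finite S \<Longrightarrow> ?thesis" by (simp add: BigOr_def set_enum_set)
qed

lemma atoms_BigAnd: "finite S \<Longrightarrow> atoms (BigAnd S) = (\<Union>F\<in>S. atoms F)"
proof -
  have "atoms (foldr And xs Top) = (\<Union>F\<in>set xs. atoms F)" for xs :: "'a form list"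
    by (induction xs) auto
  then show "finite S \<Longrightarrow> ?thesis" by (simp add: BigAnd_def set_enum_set)
qed

lemma atoms_BigOr: "finite S \<Longrightarrow> atoms (BigOr S) = (\<Union>F\<in>S. atoms F)"
proof -
  have "atoms (foldr Or xs Bot) = (\<Union>F\<in>set xs. atoms F)" for xs :: "'a form list"
    by (induction xs) auto
  then show "finite S \<Longrightarrow> ?thesis" by (simp add: BigOr_def set_enum_set)
qed


section \<open>Logic programs\<close>

text \<open>\<open>Body ps ns ds\<close> stands for the body consisting of the \<open>b\<close> in \<open>ps\<close>, the \<open>not b\<close> with \<open>b\<close>
  in \<open>ns\<close>, and the \<open>not not b\<close> with \<open>b\<close> in \<open>ds\<close>. The head \<open>None\<close> is falsum.\<close>

datatype 'a body = Body (pos: "'a list") (negs: "'a list") (dnegs: "'a list")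

datatype 'a rule = Rule (head: "'a option") (body: "'a body")

definition negative_form :: "'a body \<Rightarrow> 'a form" where
  "negative_form B =
     foldr And (map (\<lambda>b. Neg (Atm b)) (negs B) @ map (\<lambda>b. Neg (Neg (Atm b))) (dnegs B)) Top"

definition body_form :: "'a body \<Rightarrow> 'a form" where
  "body_form B = And (foldr And (map Atm (pos B)) Top) (negative_form B)"

definition head_form :: "'a option \<Rightarrow> 'a form" where
  "head_form h = (case h of None \<Rightarrow> Bot | Some a \<Rightarrow> Atm a)"

definition rule_form :: "'a rule \<Rightarrow> 'a form" where
  "rule_form r = Imp (body_form (body r)) (head_form (head r))"

definition program_over :: "'a set \<Rightarrow> 'a rule set \<Rightarrow> bool" where
  "program_over \<sigma> \<Pi> \<longleftrightarrow> finite \<Pi> \<and> (\<forall>r\<in>\<Pi>. atoms (rule_form r) \<subseteq> \<sigma>)"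

definition hd_atoms :: "'a rule set \<Rightarrow> 'a set" where
  "hd_atoms \<Pi> = {a. \<exists>r\<in>\<Pi>. head r = Some a}"

definition Bodies :: "'a rule set \<Rightarrow> 'a \<Rightarrow> 'a body set" where
  "Bodies \<Pi> a = {B. Rule (Some a) B \<in> \<Pi>}"

definition satisfies_program :: "'a set \<Rightarrow> 'a rule set \<Rightarrow> bool" where
  "satisfies_program X \<Pi> \<longleftrightarrow> (\<forall>r\<in>\<Pi>. sat X (rule_form r))"

definition reduct :: "'a rule set \<Rightarrow> 'a set \<Rightarrow> 'a rule set" where
  "reduct \<Pi> X =
     {Rule (head r) (Body (pos (body r)) [] []) | r. r \<in> \<Pi> \<and> sat X (negative_form (body r))}"

definition answer_set :: "'a rule set \<Rightarrow> 'a set \<Rightarrow> bool" where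
  "answer_set \<Pi> X \<longleftrightarrow>
     satisfies_program X (reduct \<Pi> X) \<and> (\<forall>Y. Y \<subset> X \<longrightarrow> \<not> satisfies_program Y (reduct \<Pi> X))"

definition fact :: "'a \<Rightarrow> 'a rule" where
  "fact a = Rule (Some a) (Body [] [] [])"

definition input_answer_set :: "'a set \<Rightarrow> 'a rule set \<Rightarrow> 'a set \<Rightarrow> 'a set \<Rightarrow> bool" where
  "input_answer_set \<sigma> \<Pi> \<iota> X \<longleftrightarrow> X \<subseteq> \<sigma> \<and> answer_set (\<Pi> \<union> fact ` (X \<inter> \<iota>)) X"

definition IComp :: "'a set \<Rightarrow> 'a rule set \<Rightarrow> 'a set \<Rightarrow> 'a form" where
  "IComp \<sigma> \<Pi> \<iota> =
     BigAnd (rule_form ` \<Pi> \<union>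
             (\<lambda>a. Imp (Atm a) (BigOr (body_form ` Bodies \<Pi> a))) ` (\<sigma> - \<iota>))"


section \<open>Integer linear constraints\<close>

datatype rel = Less | Greater | LessEq | GreaterEq | Equal | NotEqual

fun rel_holds :: "rel \<Rightarrow> int \<Rightarrow> int \<Rightarrow> bool" where
  "rel_holds Less x y \<longleftrightarrow> x < y"
| "rel_holds Greater x y \<longleftrightarrow> x > y"
| "rel_holds LessEq x y \<longleftrightarrow> x \<le> y"
| "rel_holds GreaterEq x y \<longleftrightarrow> x \<ge> y"
| "rel_holds Equal x y \<longleftrightarrow> x = y"
| "rel_holds NotEqual x y \<longleftrightarrow> x \<noteq> y"

text \<open>Constraints are kept syntactic: collecting the coefficients of equal variables would identify
  the constraints \<open>x - x \<ge> 1\<close> and \<open>y - y \<ge> 1\<close>, and the map \<open>lr_gamma\<close> below would not be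
  injective.\<close>

datatype 'v linear_constraint = LinCon "(int \<times> 'v) list" rel int

fun con_vars :: "'v linear_constraint \<Rightarrow> 'v set" where
  "con_vars (LinCon ts r k) = snd ` set ts"

fun con_holds :: "('v \<Rightarrow> int) \<Rightarrow> 'v linear_constraint \<Rightarrow> bool" where
  "con_holds \<nu> (LinCon ts r k) \<longleftrightarrow> rel_holds r (\<Sum>(a, x)\<leftarrow>ts. a * \<nu> x) k"

datatype 'v constraint_literal =
    PosCon "'v linear_constraint"
  | NegCon "'v linear_constraint"

fun lit_holds :: "('v \<Rightarrow> int) \<Rightarrow> 'v constraint_literal \<Rightarrow> bool" where
  "lit_holds \<nu> (PosCon c) \<longleftrightarrow> con_holds \<nu> c"
| "lit_holds \<nu> (NegCon c) \<longleftrightarrow> \<not> con_holds \<nu> c"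

definition gcsp_solution :: "'v constraint_literal set \<Rightarrow> ('v \<Rightarrow> int) \<Rightarrow> bool" where
  "gcsp_solution S \<nu> \<longleftrightarrow> (\<forall>l\<in>S. lit_holds \<nu> l)"


section \<open>Constraint formulas\<close>

text \<open>Only the values of \<open>cf_gamma\<close> on the irregular atoms matter.\<close>

record ('b, 'v) constraint_formula =
  cf_regular :: "'b set"
  cf_irregular :: "'b set"
  cf_form :: "'b form"
  cf_constraints :: "'v linear_constraint set"
  cf_gamma :: "'b \<Rightarrow> 'v linear_constraint"

definition wf_constraint_formula :: "('b, 'v) constraint_formula \<Rightarrow> bool" where
  "wf_constraint_formula C \<longleftrightarrow>
     cf_regular C \<inter> cf_irregular C = {} \<and>
     atoms (cf_form C) \<subseteq> cf_regular C \<union> cf_irregular C \<and>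
     inj_on (cf_gamma C) (cf_irregular C) \<and>
     cf_gamma C ` cf_irregular C \<subseteq> cf_constraints C"

definition cf_gcsp :: "('b, 'v) constraint_formula \<Rightarrow> 'b set \<Rightarrow> 'v constraint_literal set" where
  "cf_gcsp C Y =
     {PosCon (cf_gamma C a) | a. a \<in> Y \<inter> cf_irregular C} \<union>
     {NegCon (cf_gamma C a) | a. a \<in> (atoms (cf_form C) \<inter> cf_irregular C) - Y}"

text \<open>Models are sets of atoms occurring in the formula (\<open>cf_model\<close>) or, more liberally, sets of
  atoms of its vocabulary (\<open>cf_model_over_vocabulary\<close>). The two notions differ only for formulas
  in which some atoms of the vocabulary do not occur. For \<open>IComp_R\<close> below, these are the input
  atoms that occur in no rule: with the empty program and \<open>\<sigma> = \<iota> = X = {p}\<close>, the set \<open>X\<close> is an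
  input answer set, but \<open>p\<close> does not occur in the formula.\<close>

definition cf_model_within ::
    "'b set \<Rightarrow> ('b, 'v) constraint_formula \<Rightarrow> 'b set \<Rightarrow> bool" where
  "cf_model_within W C Y \<longleftrightarrow>
     Y \<subseteq> W \<and> sat Y (cf_form C) \<and> (\<exists>\<nu>. gcsp_solution (cf_gcsp C Y) \<nu>)"

definition cf_model :: "('b, 'v) constraint_formula \<Rightarrow> 'b set \<Rightarrow> bool" where
  "cf_model C Y \<longleftrightarrow> cf_model_within (atoms (cf_form C)) C Y"

definition cf_model_over_vocabulary :: "('b, 'v) constraint_formula \<Rightarrow> 'b set \<Rightarrow> bool" where
  "cf_model_over_vocabulary C Y \<longleftrightarrow> cf_model_within (cf_regular C \<union> cf_irregular C) C Y"


section \<open>Level rankings\<close>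

datatype 'a lr_var = LR 'a

text \<open>\<open>Irr a b\<close> is the fresh propositional atom \<open>|lr_a - 1 \<ge> lr_b|\<close>; an atom \<open>a\<close> of the original
  vocabulary becomes \<open>Reg a\<close>.\<close>

datatype 'a xatom = Reg 'a | Irr 'a 'a

definition R_form :: "'a set \<Rightarrow> 'a rule set \<Rightarrow> 'a set \<Rightarrow> 'a xatom form" where
  "R_form \<sigma> \<Pi> \<iota> =
     BigAnd ((\<lambda>a. Imp (Atm (Reg a))
       (Or (BigOr {And (map_form Reg (body_form B))
                       (BigAnd {Atm (Irr a b) | b. b \<in> set (pos B) - \<iota>})
                  | B. B \<in> Bodies \<Pi> a \<and> set (pos B) - \<iota> \<noteq> {}})
           (BigOr {map_form Reg (body_form B)
                  | B. B \<in> Bodies \<Pi> a \<and> set (pos B) - \<iota> = {}}))) ` (\<sigma> - \<iota>))"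

definition irregular_atoms :: "'a set \<Rightarrow> 'a rule set \<Rightarrow> 'a set \<Rightarrow> 'a xatom set" where
  "irregular_atoms \<sigma> \<Pi> \<iota> = {Irr a b | a b. Irr a b \<in> atoms (R_form \<sigma> \<Pi> \<iota>)}"

definition lr_vars :: "'a set \<Rightarrow> 'a rule set \<Rightarrow> 'a set \<Rightarrow> 'a lr_var set" where
  "lr_vars \<sigma> \<Pi> \<iota> = (\<Union>{{LR a, LR b} | a b. Irr a b \<in> irregular_atoms \<sigma> \<Pi> \<iota>})"

definition lr_constraints ::
    "'a set \<Rightarrow> 'a rule set \<Rightarrow> 'a set \<Rightarrow> 'a lr_var linear_constraint set" where
  "lr_constraints \<sigma> \<Pi> \<iota> = {c. con_vars c \<subseteq> lr_vars \<sigma> \<Pi> \<iota>}"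

fun lr_gamma :: "'a xatom \<Rightarrow> 'a lr_var linear_constraint" where
  "lr_gamma (Irr a b) = LinCon [(1, LR a), (-1, LR b)] GreaterEq 1"
| "lr_gamma (Reg a) = undefined"

definition IComp_R ::
    "'a set \<Rightarrow> 'a rule set \<Rightarrow> 'a set \<Rightarrow> ('a xatom, 'a lr_var) constraint_formula" where
  "IComp_R \<sigma> \<Pi> \<iota> =
     \<lparr> cf_regular = Reg ` \<sigma>,
       cf_irregular = irregular_atoms \<sigma> \<Pi> \<iota>,
       cf_form = And (map_form Reg (IComp \<sigma> \<Pi> \<iota>)) (R_form \<sigma> \<Pi> \<iota>),
       cf_constraints = lr_constraints \<sigma> \<Pi> \<iota>,
       cf_gamma = lr_gamma \<rparr>"

lemma finite_Bodies: "finite \<Pi> \<Longrightarrow> finite (Bodies \<Pi> a)"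
proof -
  assume "finite \<Pi>"
  moreover have "Bodies \<Pi> a \<subseteq> body ` \<Pi>" by (force simp: Bodies_def)
  ultimately show ?thesis by (meson finite_imageI finite_subset)
qed

lemma atoms_body_subset:
  assumes "program_over \<sigma> \<Pi>" "B \<in> Bodies \<Pi> a"
  shows "atoms (body_form B) \<subseteq> \<sigma>"
  using assms by (force simp: program_over_def Bodies_def rule_form_def)

lemma wf_IComp_R:
  assumes "finite \<sigma>" and \<Pi>: "program_over \<sigma> \<Pi>"
  shows "wf_constraint_formula (IComp_R \<sigma> \<Pi> \<iota>)"
proof -
  have fin: "finite \<Pi>" "\<And>a. finite (Bodies \<Pi> a)"
    using \<Pi> by (auto simp: program_over_def finite_Bodies)
  have IC: "atoms (IComp \<sigma> \<Pi> \<iota>) \<subseteq> \<sigma>"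
  proof -
    have 1: "atoms (rule_form r) \<subseteq> \<sigma>" if "r \<in> \<Pi>" for r
      using \<Pi> that by (auto simp: program_over_def)
    have 2: "atoms (BigOr (body_form ` Bodies \<Pi> a)) \<subseteq> \<sigma>" for a
      using fin atoms_body_subset[OF \<Pi>] by (simp add: atoms_BigOr UN_least)
    show ?thesis
      unfolding IComp_def
    proof (subst atoms_BigAnd, use fin(1) assms(1) in simp, intro UN_least, elim UnE imageE; hypsubst)
      show "atoms (rule_form r) \<subseteq> \<sigma>" if "r \<in> \<Pi>" for r
        using that by (rule 1)
      show "atoms (Imp (Atm a) (BigOr (body_form ` Bodies \<Pi> a))) \<subseteq> \<sigma>" if "a \<in> \<sigma> - \<iota>" for a
        using that 2[of a] by simp
    qed
  qed
  have R: "atoms (R_form \<sigma> \<Pi> \<iota>) \<subseteq> Reg ` \<sigma> \<union> {Irr a b | a b. True}"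
    (is "_ \<subseteq> ?V")
  proof -
    have 1: "atoms (map_form Reg (body_form B)) \<subseteq> ?V" if "B \<in> Bodies \<Pi> a" for a B
      using atoms_body_subset[OF \<Pi> that] by (auto simp: form.set_map)
    have 2: "atoms (BigAnd {Atm (Irr a b) | b. b \<in> set (pos B) - \<iota>}) \<subseteq> ?V" for a B
    proof -
      have "finite {Atm (Irr a b) | b. b \<in> set (pos B) - \<iota>}" by simp
      then show ?thesis by (subst atoms_BigAnd) auto
    qed
    have 3: "atoms (BigOr {f B | B. B \<in> Bodies \<Pi> a \<and> P B}) \<subseteq> ?V"
      if "\<And>B. B \<in> Bodies \<Pi> a \<Longrightarrow> atoms (f B) \<subseteq> ?V" for f P a
    proof -
      have "finite {f B | B. B \<in> Bodies \<Pi> a \<and> P B}" using fin by simp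
      then show ?thesis using that by (subst atoms_BigOr) blast+
    qed
    show ?thesis
      unfolding R_form_def
    proof (subst atoms_BigAnd, use assms(1) in simp, intro UN_least, elim imageE, hypsubst)
      fix a assume "a \<in> \<sigma> - \<iota>"
      then show "atoms (Imp (Atm (Reg a))
         (Or (BigOr {And (map_form Reg (body_form B))
                         (BigAnd {Atm (Irr a b) | b. b \<in> set (pos B) - \<iota>})
                    | B. B \<in> Bodies \<Pi> a \<and> set (pos B) - \<iota> \<noteq> {}})
             (BigOr {map_form Reg (body_form B)
                    | B. B \<in> Bodies \<Pi> a \<and> set (pos B) - \<iota> = {}}))) \<subseteq> ?V"
        unfolding form.set Un_subset_iff
        by (intro conjI 3) (use \<open>a \<in> \<sigma> - \<iota>\<close> in blast, (intro Un_least 1 2 | assumption | simp only: form.set)+)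
    qed
  qed
  have inj: "inj_on lr_gamma (irregular_atoms \<sigma> \<Pi> \<iota>)"
    by (auto simp: inj_on_def irregular_atoms_def)
  have vars: "lr_gamma ` irregular_atoms \<sigma> \<Pi> \<iota> \<subseteq> lr_constraints \<sigma> \<Pi> \<iota>"
  proof
    fix c assume "c \<in> lr_gamma ` irregular_atoms \<sigma> \<Pi> \<iota>"
    then obtain a b where ab: "Irr a b \<in> irregular_atoms \<sigma> \<Pi> \<iota>" "c = lr_gamma (Irr a b)"
      by (auto simp: irregular_atoms_def)
    then have "{LR a, LR b} \<subseteq> lr_vars \<sigma> \<Pi> \<iota>"
      unfolding lr_vars_def by blast
    with ab(2) show "c \<in> lr_constraints \<sigma> \<Pi> \<iota>"
      by (simp add: lr_constraints_def)
  qed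
  have at: "atoms (R_form \<sigma> \<Pi> \<iota>) \<subseteq> Reg ` \<sigma> \<union> irregular_atoms \<sigma> \<Pi> \<iota>"
    using R by (auto simp: irregular_atoms_def)
  have "Reg ` \<sigma> \<inter> irregular_atoms \<sigma> \<Pi> \<iota> = {}"
    by (auto simp: irregular_atoms_def)
  then show ?thesis
    using IC at inj vars by (auto simp: wf_constraint_formula_def IComp_R_def form.set_map)
qed

end

theory Submission imports Defs begin

text \<open>A valuation of the variables \<open>lr\<close> that solves the constraints is a level ranking: every
  non-input atom of \<open>X\<close> is supported by a rule whose positive non-input atoms are ranked strictly
  lower. An answer set has such a ranking, namely the least number of steps in which an atom is
  derived from the reduct. Conversely, given such a ranking, a model \<open>Y\<close> of the reduct that is
  strictly smaller than \<open>X\<close> would miss an atom of \<open>X\<close> of least rank, but the rule supporting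
  this atom puts it into \<open>Y\<close>.\<close>

definition level_ranking :: "'a set \<Rightarrow> 'a rule set \<Rightarrow> 'a set \<Rightarrow> ('a \<Rightarrow> int) \<Rightarrow> bool" where
  "level_ranking \<iota> \<Pi> X \<nu> \<longleftrightarrow>
     (\<forall>a\<in>X - \<iota>. \<exists>B\<in>Bodies \<Pi> a. sat X (body_form B) \<and> (\<forall>b\<in>set (pos B) - \<iota>. \<nu> a - 1 \<ge> \<nu> b))"

section \<open>Satisfaction of bodies, reducts and facts\<close>

lemma sat_foldr_And: "sat X (foldr And Fs Top) \<longleftrightarrow> (\<forall>F\<in>set Fs. sat X F)"
  by (induction Fs) auto

lemma sat_body_form:
  "sat X (body_form B) \<longleftrightarrow> set (pos B) \<subseteq> X \<and> sat X (negative_form B)"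
  by (auto simp: body_form_def sat_foldr_And)

lemma satisfies_program_iff:
  "satisfies_program X \<Pi> \<longleftrightarrow>
     (\<forall>h B. Rule h B \<in> \<Pi> \<longrightarrow> sat X (body_form B) \<longrightarrow> sat X (head_form h))"
  unfolding satisfies_program_def rule_form_def by (metis rule.collapse rule.sel sat.simps(7))

lemma satisfies_reduct_iff:
  "satisfies_program Y (reduct \<Pi> X) \<longleftrightarrow>
     (\<forall>h B. Rule h B \<in> \<Pi> \<longrightarrow> sat X (negative_form B) \<longrightarrow> set (pos B) \<subseteq> Y \<longrightarrow> sat Y (head_form h))"
proof -
  have "satisfies_program Y (reduct \<Pi> X) \<longleftrightarrow>
      (\<forall>r\<in>\<Pi>. sat X (negative_form (body r)) \<longrightarrow> set (pos (body r)) \<subseteq> Y \<longrightarrow> sat Y (head_form (head r)))"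
  proof -
    have rule: "sat Y (rule_form (Rule h (Body bs [] []))) \<longleftrightarrow> (set bs \<subseteq> Y \<longrightarrow> sat Y (head_form h))"
      for h bs
      by (simp add: rule_form_def sat_body_form negative_form_def)
    have "reduct \<Pi> X = (\<lambda>r. Rule (head r) (Body (pos (body r)) [] [])) `
        {r \<in> \<Pi>. sat X (negative_form (body r))}"
      by (auto simp: reduct_def)
    then show ?thesis
      by (auto simp: satisfies_program_def rule)
  qed
  then show ?thesis
    by (metis rule.collapse rule.sel)
qed

text \<open>The negative part of a fact is empty, so every reduct keeps the fact unchanged, and a
  fact demands only that its atom belong to \<open>Y\<close>.\<close>

lemma satisfies_reduct_facts_iff:
  "satisfies_program Y (reduct (\<Pi> \<union> fact ` A) X) \<longleftrightarrow>
     satisfies_program Y (reduct \<Pi> X) \<and> A \<subseteq> Y"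
proof -
  have "satisfies_program Y (reduct (\<Pi> \<union> fact ` A) X) \<longleftrightarrow>
      satisfies_program Y (reduct \<Pi> X) \<and> satisfies_program Y (reduct (fact ` A) X)"
    unfolding satisfies_reduct_iff by blast
  moreover have "reduct (fact ` A) X = fact ` A"
    by (force simp: reduct_def fact_def negative_form_def)
  moreover have "satisfies_program Y (fact ` A) \<longleftrightarrow> A \<subseteq> Y"
    by (auto simp: satisfies_program_def fact_def rule_form_def sat_body_form negative_form_def
        head_form_def)
  ultimately show ?thesis
    by simp
qed

text \<open>The reduct evaluates negative parts in \<open>X\<close>; when the positive part is
  evaluated in \<open>X\<close> too, the two together amount to satisfaction of the whole
  body.\<close>

lemma satisfies_reduct_self: "satisfies_program X (reduct \<Pi> X) \<longleftrightarrow> satisfies_program X \<Pi>"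
  unfolding satisfies_reduct_iff satisfies_program_iff[of X \<Pi>] sat_body_form
  by (intro iff_allI) blast

text \<open>Eliminates the added facts: they become a lower bound \<open>A\<close> on
  \<open>X\<close> and on the competing sets \<open>Y\<close>, and only the reduct of
  \<open>\<Pi>\<close> itself remains.\<close>

lemma answer_set_facts_iff:
  "answer_set (\<Pi> \<union> fact ` A) X \<longleftrightarrow> satisfies_program X \<Pi> \<and> A \<subseteq> X \<and>
     (\<forall>Y. Y \<subset> X \<longrightarrow> A \<subseteq> Y \<longrightarrow> \<not> satisfies_program Y (reduct \<Pi> X))"
  unfolding answer_set_def satisfies_reduct_facts_iff unfolding satisfies_reduct_self by blast

section \<open>Derivation in stages from the reduct\<close>

text \<open>Bottom-up closure of \<open>A\<close> under the reduct of \<open>\<Pi>\<close> by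
  \<open>X\<close>. The index only bounds the height of a derivation: inputs are available at every
  stage, and the atoms of one body may come from different earlier stages.\<close>

inductive derives :: "'a rule set \<Rightarrow> 'a set \<Rightarrow> 'a set \<Rightarrow> nat \<Rightarrow> 'a \<Rightarrow> bool" for \<Pi> A X where
  input: "a \<in> A \<Longrightarrow> derives \<Pi> A X n a"
| rule: "B \<in> Bodies \<Pi> a \<Longrightarrow> sat X (negative_form B) \<Longrightarrow>
    \<forall>b\<in>set (pos B). \<exists>m<n. derives \<Pi> A X m b \<Longrightarrow> derives \<Pi> A X n a"

text \<open>Negative parts are evaluated in \<open>X\<close>, so by induction each applied rule has
  its whole body true in \<open>X\<close>, and the model \<open>X\<close> is never left.\<close>

lemma derives_subset:
  assumes "derives \<Pi> A X n a" "satisfies_program X \<Pi>" "A \<subseteq> X"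
  shows "a \<in> X"
  using assms(1)
proof induction
  case (rule B a n)
  then have "sat X (body_form B)"
    by (auto simp: sat_body_form)
  with rule(1) assms(2) have "sat X (head_form (Some a))"
    unfolding satisfies_program_iff Bodies_def by blast
  then show ?case
    by (simp add: head_form_def)
qed (use assms(3) in blast)

lemma derives_closed:
  assumes "B \<in> Bodies \<Pi> a" "sat X (negative_form B)" "\<forall>b\<in>set (pos B). \<exists>n. derives \<Pi> A X n b"
  shows "\<exists>n. derives \<Pi> A X n a"
proof -
  obtain f where f: "\<forall>b\<in>set (pos B). derives \<Pi> A X (f b) b"
    using assms(3) by metis
  \<comment> \<open>Bodies are finite, so one more than the largest chosen stage lies above all of
    them. For an empty positive part \<open>Max\<close> is unspecified, but then nothing has to be
    bounded.\<close>
  have "f b < Suc (Max (f ` set (pos B)))" if "b \<in> set (pos B)" for b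
    using that by (simp add: less_Suc_eq_le)
  with f assms(1,2) show ?thesis
    by (intro exI derives.rule[of B]) blast+
qed

text \<open>The derivable atoms form a subset of \<open>X\<close> that contains the inputs and
  satisfies the reduct; minimality of \<open>X\<close> leaves no room for a proper subset.\<close>

lemma answer_set_derives:
  assumes "answer_set (\<Pi> \<union> fact ` (X \<inter> \<iota>)) X" and "a \<in> X"
  shows "\<exists>n. derives \<Pi> (X \<inter> \<iota>) X n a"
proof -
  let ?U = "{a. \<exists>n. derives \<Pi> (X \<inter> \<iota>) X n a}"
  have X: "satisfies_program X \<Pi>"
    using assms(1) by (simp add: answer_set_facts_iff)
  have sub: "?U \<subseteq> X"
    using derives_subset[OF _ X] by blast
  have closed: "sat ?U (head_form h)"
    if "Rule h B \<in> \<Pi>" "sat X (negative_form B)" "set (pos B) \<subseteq> ?U" for h B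
  proof (cases h)
    case None
    \<comment> \<open>As the derivable atoms lie in \<open>X\<close>, the body holds in
      \<open>X\<close> as well; with head falsum this contradicts that \<open>X\<close> satisfies
      the program.\<close>
    have "sat X (head_form h)"
      using X that sub unfolding satisfies_program_iff sat_body_form by blast
    with None show ?thesis
      by (simp add: head_form_def)
  next
    case (Some a)
    then have "\<exists>n. derives \<Pi> (X \<inter> \<iota>) X n a"
      using that by (intro derives_closed[of B]) (auto simp: Bodies_def)
    with Some show ?thesis
      by (simp add: head_form_def)
  qed
  have "X \<inter> \<iota> \<subseteq> ?U"
    by (auto intro: derives.input)
  moreover have "satisfies_program ?U (reduct \<Pi> X)"
    unfolding satisfies_reduct_iff using closed by blast
  ultimately have "?U = X"
    using assms(1) sub unfolding answer_set_facts_iff by blast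
  with assms(2) show ?thesis
    by blast
qed

section \<open>Answer sets and level rankings\<close>

lemma answer_set_imp_level_ranking:
  assumes ans: "answer_set (\<Pi> \<union> fact ` (X \<inter> \<iota>)) X"
  shows "\<exists>\<nu>. level_ranking \<iota> \<Pi> X \<nu>"
proof
  let ?D = "derives \<Pi> (X \<inter> \<iota>) X"
  let ?\<nu> = "\<lambda>a. LEAST n. ?D n a"
  have X: "satisfies_program X \<Pi>"
    using ans by (simp add: answer_set_facts_iff)
  show "level_ranking \<iota> \<Pi> X (\<lambda>a. int (?\<nu> a))"
    unfolding level_ranking_def
  proof
    fix a assume a: "a \<in> X - \<iota>"
    then have "\<exists>n. ?D n a"
      using answer_set_derives[OF ans] by blast
    then have "?D (?\<nu> a) a"
      by (rule LeastI_ex)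
    \<comment> \<open>Inspect the last step of a derivation of least height: it is not
      \<open>input\<close>, since \<open>a\<close> lies outside \<open>\<iota>\<close>.\<close>
    then obtain B where B: "B \<in> Bodies \<Pi> a" "sat X (negative_form B)"
      "\<forall>b\<in>set (pos B). \<exists>m<?\<nu> a. ?D m b"
      using a by (cases rule: derives.cases) auto
    \<comment> \<open>The least stage of \<open>b\<close> is at most the stage \<open>m\<close> at
      which the derivation uses it.\<close>
    have "?\<nu> b < ?\<nu> a" if "b \<in> set (pos B)" for b
      using B(3) that by (blast intro: Least_le le_less_trans)
    moreover have "set (pos B) \<subseteq> X"
      using B(3) derives_subset[OF _ X] by blast
    ultimately show "\<exists>B\<in>Bodies \<Pi> a. sat X (body_form B) \<and>
        (\<forall>b\<in>set (pos B) - \<iota>. int (?\<nu> a) - 1 \<ge> int (?\<nu> b))"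
      using B(1,2) by (force simp: sat_body_form)
  qed
qed

lemma level_ranking_imp_answer_set:
  assumes "finite X" and X: "satisfies_program X \<Pi>" and \<nu>: "level_ranking \<iota> \<Pi> X \<nu>"
  shows "answer_set (\<Pi> \<union> fact ` (X \<inter> \<iota>)) X"
  unfolding answer_set_facts_iff
proof (intro conjI allI impI notI X)
  fix Y assume "Y \<subset> X" and Y: "X \<inter> \<iota> \<subseteq> Y" "satisfies_program Y (reduct \<Pi> X)"
  \<comment> \<open>Integer ranks are not well-founded; a least one exists here because
    \<open>X - Y\<close> is finite.\<close>
  have "finite (X - Y)" "X - Y \<noteq> {}"
    using \<open>finite X\<close> \<open>Y \<subset> X\<close> by auto
  then obtain a where a: "a \<in> X - Y" and least: "\<And>b. b \<in> X - Y \<Longrightarrow> \<nu> a \<le> \<nu> b"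
    using ex_min_if_finite[of "\<nu> ` (X - Y)"] by (metis (no_types, lifting) finite_imageI imageE
        image_eqI image_is_empty not_less)
  obtain B where B: "B \<in> Bodies \<Pi> a" "sat X (body_form B)"
    \<comment> \<open>The ranking applies to \<open>a\<close>: an input atom of \<open>X\<close>
      would already be in \<open>Y\<close>.\<close>
    "\<forall>b\<in>set (pos B) - \<iota>. \<nu> a - 1 \<ge> \<nu> b"
    using \<nu> a Y(1) unfolding level_ranking_def by blast
  have "set (pos B) \<subseteq> Y"
  proof
    fix b assume b: "b \<in> set (pos B)"
    then have "b \<in> X"
      using B(2) by (auto simp: sat_body_form)
    moreover have "b \<notin> X - Y" if "b \<notin> \<iota>"
    proof -
      have "\<nu> b < \<nu> a"
        using b B(3) that by auto
      with least[of b] show ?thesis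
        by linarith
    qed
    \<comment> \<open>Input atoms are in \<open>Y\<close> by assumption, the others by the choice of
      \<open>a\<close>.\<close>
    ultimately show "b \<in> Y"
      using Y(1) by blast
  qed
  then have "sat Y (head_form (Some a))"
    using Y(2) B(1,2) unfolding satisfies_reduct_iff sat_body_form Bodies_def by blast
  with a show False
    by (simp add: head_form_def)
qed auto

lemma answer_set_iff_level_ranking:
  assumes "finite X"
  shows "answer_set (\<Pi> \<union> fact ` (X \<inter> \<iota>)) X \<longleftrightarrow>
    satisfies_program X \<Pi> \<and> (\<exists>\<nu>. level_ranking \<iota> \<Pi> X \<nu>)"
proof
  assume ans: "answer_set (\<Pi> \<union> fact ` (X \<inter> \<iota>)) X"
  then have "satisfies_program X \<Pi>"
    by (simp add: answer_set_facts_iff)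
  with answer_set_imp_level_ranking[OF ans]
  show "satisfies_program X \<Pi> \<and> (\<exists>\<nu>. level_ranking \<iota> \<Pi> X \<nu>)"
    by blast
qed (use level_ranking_imp_answer_set[OF assms] in blast)

section \<open>Meaning of the formulas \<open>IComp\<close> and \<open>R_form\<close>\<close>

lemma sat_map_form: "sat Y (map_form f F) \<longleftrightarrow> sat (f -` Y) F"
  by (induction F) auto

lemma sat_IComp:
  assumes "finite \<sigma>" "finite \<Pi>"
  shows "sat X (IComp \<sigma> \<Pi> \<iota>) \<longleftrightarrow> satisfies_program X \<Pi> \<and>
    (\<forall>a\<in>X \<inter> (\<sigma> - \<iota>). \<exists>B\<in>Bodies \<Pi> a. sat X (body_form B))"
proof -
  have "sat X (BigOr (body_form ` Bodies \<Pi> a)) \<longleftrightarrow> (\<exists>B\<in>Bodies \<Pi> a. sat X (body_form B))" for a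
    using assms by (simp add: sat_BigOr finite_Bodies)
  then show ?thesis
    using assms unfolding IComp_def satisfies_program_def
    by (subst sat_BigAnd) (auto simp: ball_Un)
qed

lemma sat_BigAnd_Irr:
  "sat Y (BigAnd {Atm (Irr a b) | b. b \<in> set bs - \<iota>}) \<longleftrightarrow> (\<forall>b\<in>set bs - \<iota>. Irr a b \<in> Y)"
proof -
  have "finite {Atm (Irr a b) | b. b \<in> set bs - \<iota>}"
    by simp
  then show ?thesis
    by (subst sat_BigAnd) auto
qed

text \<open>The two disjunctions of \<open>R_form\<close> merge into one existential statement: for
  a body without positive non-input atoms the ranking condition is vacuous.\<close>

lemma sat_R_form:
  assumes "finite \<sigma>" "finite \<Pi>"
  shows "sat Y (R_form \<sigma> \<Pi> \<iota>) \<longleftrightarrow>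
    (\<forall>a\<in>\<sigma> - \<iota>. Reg a \<in> Y \<longrightarrow> (\<exists>B\<in>Bodies \<Pi> a. sat (Reg -` Y) (body_form B) \<and>
       (\<forall>b\<in>set (pos B) - \<iota>. Irr a b \<in> Y)))"
proof -
  \<comment> \<open>Stated for arbitrary \<open>f\<close> and \<open>P\<close> so as to cover both
    disjunctions.\<close>
  have "sat Y (BigOr {f B | B. B \<in> Bodies \<Pi> a \<and> P B}) \<longleftrightarrow>
      (\<exists>B\<in>Bodies \<Pi> a. P B \<and> sat Y (f B))" for f P a
    using finite_Bodies[OF assms(2), of a] by (subst sat_BigOr) auto
  note sat_BigOr = this
  show ?thesis
    unfolding R_form_def sat_BigAnd[OF finite_imageI[OF finite_Diff[OF assms(1)]]]
      ball_simps sat.simps sat_BigOr sat_BigAnd_Irr sat_map_form vimage_def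
    by (intro ball_cong imp_cong refl) blast
qed

text \<open>Irregular atoms are those that occur in \<open>R_form\<close>. This guarantees that
  every comparison required by a level ranking is available as such an atom.\<close>

lemma Irr_in_irregular_atoms:
  assumes "finite \<sigma>" "finite \<Pi>" "a \<in> \<sigma> - \<iota>" "B \<in> Bodies \<Pi> a" "b \<in> set (pos B) - \<iota>"
  shows "Irr a b \<in> irregular_atoms \<sigma> \<Pi> \<iota>"
proof -
  let ?I = "{Atm (Irr a b) | b. b \<in> set (pos B) - \<iota>}"
  let ?C = "{And (map_form Reg (body_form B)) (BigAnd {Atm (Irr a b) | b. b \<in> set (pos B) - \<iota>})
    | B. B \<in> Bodies \<Pi> a \<and> set (pos B) - \<iota> \<noteq> {}}"
  have fin: "finite ?I" "finite ?C"
    using finite_Bodies[OF assms(2), of a] by auto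
  have "Irr a b \<in> atoms (BigAnd ?I)"
    using assms(5) by (subst atoms_BigAnd[OF fin(1)]) auto
  then have "Irr a b \<in> atoms (And (map_form Reg (body_form B)) (BigAnd ?I))"
    by simp
  moreover have "And (map_form Reg (body_form B)) (BigAnd ?I) \<in> ?C"
    using assms(4,5) by blast
  ultimately have "Irr a b \<in> atoms (BigOr ?C)"
    unfolding atoms_BigOr[OF fin(2)] by blast
  then have "Irr a b \<in> atoms (R_form \<sigma> \<Pi> \<iota>)"
    using assms(1,3) unfolding R_form_def by (subst atoms_BigAnd) auto
  then show ?thesis
    by (simp add: irregular_atoms_def)
qed

lemma irregular_atoms_subset: "irregular_atoms \<sigma> \<Pi> \<iota> \<subseteq> atoms (R_form \<sigma> \<Pi> \<iota>)"
  by (auto simp: irregular_atoms_def)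

section \<open>Models of the constraint formula\<close>

text \<open>The GCSP contains the constraint of each atom in \<open>Xi\<close> and the negated
  constraint of every other irregular atom, so a solution determines \<open>Xi\<close>
  completely.\<close>

lemma gcsp_solution_IComp_R_iff:
  assumes "Xi \<subseteq> irregular_atoms \<sigma> \<Pi> \<iota>"
  shows "gcsp_solution (cf_gcsp (IComp_R \<sigma> \<Pi> \<iota>) (Reg ` X \<union> Xi)) \<nu> \<longleftrightarrow>
    Xi = {Irr a b | a b. Irr a b \<in> irregular_atoms \<sigma> \<Pi> \<iota> \<and> \<nu> (LR a) - 1 \<ge> \<nu> (LR b)}"
proof -
  let ?C = "IComp_R \<sigma> \<Pi> \<iota>"
  have irr: "\<exists>a b. x = Irr a b" if "x \<in> irregular_atoms \<sigma> \<Pi> \<iota>" for x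
    using that by (auto simp: irregular_atoms_def)
  have holds: "con_holds \<nu> (lr_gamma (Irr a b)) \<longleftrightarrow> \<nu> (LR a) - 1 \<ge> \<nu> (LR b)" for a b
    by auto
  have "(Reg ` X \<union> Xi) \<inter> irregular_atoms \<sigma> \<Pi> \<iota> = Xi"
    using assms irr by auto
  \<comment> \<open>All irregular atoms occur in the formula, hence none escapes being
    negated.\<close>
  moreover have "atoms (cf_form ?C) \<inter> irregular_atoms \<sigma> \<Pi> \<iota> - (Reg ` X \<union> Xi)
      = irregular_atoms \<sigma> \<Pi> \<iota> - Xi"
    using irregular_atoms_subset irr by (fastforce simp: IComp_R_def)
  ultimately have "gcsp_solution (cf_gcsp ?C (Reg ` X \<union> Xi)) \<nu> \<longleftrightarrow>
      (\<forall>x\<in>Xi. con_holds \<nu> (lr_gamma x)) \<and>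
      (\<forall>x\<in>irregular_atoms \<sigma> \<Pi> \<iota> - Xi. \<not> con_holds \<nu> (lr_gamma x))"
    unfolding gcsp_solution_def cf_gcsp_def Setcompr_eq_image Collect_mem_eq ball_Un
    by (simp add: IComp_R_def)
  also have "\<dots> \<longleftrightarrow> Xi = {x \<in> irregular_atoms \<sigma> \<Pi> \<iota>. con_holds \<nu> (lr_gamma x)}"
    using assms by blast
  also have "{x \<in> irregular_atoms \<sigma> \<Pi> \<iota>. con_holds \<nu> (lr_gamma x)} =
      {Irr a b | a b. Irr a b \<in> irregular_atoms \<sigma> \<Pi> \<iota> \<and> \<nu> (LR a) - 1 \<ge> \<nu> (LR b)}"
    unfolding holds[symmetric] using irr by blast
  finally show ?thesis .
qed

text \<open>Since a solution determines \<open>Xi\<close>, the search for a model becomes a search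
  for a valuation; \<open>R_form\<close> then says that this valuation ranks
  \<open>X\<close>.\<close>

lemma cf_model_over_vocabulary_iff_level_ranking:
  assumes fin: "finite \<sigma>" "finite \<Pi>" and "X \<subseteq> \<sigma>"
  shows "(\<exists>Xi \<subseteq> irregular_atoms \<sigma> \<Pi> \<iota>.
      cf_model_over_vocabulary (IComp_R \<sigma> \<Pi> \<iota>) (Reg ` X \<union> Xi)) \<longleftrightarrow>
    satisfies_program X \<Pi> \<and> (\<exists>\<nu>. level_ranking \<iota> \<Pi> X \<nu>)"
proof -
  let ?Irr = "irregular_atoms \<sigma> \<Pi> \<iota>"
  define ranked :: "('a lr_var \<Rightarrow> int) \<Rightarrow> 'a xatom set" where
    "ranked \<nu> = {Irr a b | a b. Irr a b \<in> ?Irr \<and> \<nu> (LR a) - 1 \<ge> \<nu> (LR b)}" for \<nu>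
  have model: "cf_model_over_vocabulary (IComp_R \<sigma> \<Pi> \<iota>) (Reg ` X \<union> Xi) \<longleftrightarrow>
      sat X (IComp \<sigma> \<Pi> \<iota>) \<and> sat (Reg ` X \<union> Xi) (R_form \<sigma> \<Pi> \<iota>) \<and> (\<exists>\<nu>. Xi = ranked \<nu>)"
    if "Xi \<subseteq> ?Irr" for Xi
  proof -
    have "Reg -` (Reg ` X \<union> Xi) = X"
      using that by (auto simp: irregular_atoms_def)
    then have "sat (Reg ` X \<union> Xi) (cf_form (IComp_R \<sigma> \<Pi> \<iota>)) \<longleftrightarrow>
        sat X (IComp \<sigma> \<Pi> \<iota>) \<and> sat (Reg ` X \<union> Xi) (R_form \<sigma> \<Pi> \<iota>)"
      by (simp add: IComp_R_def sat_map_form)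
    moreover have "Reg ` X \<union> Xi \<subseteq>
        cf_regular (IComp_R \<sigma> \<Pi> \<iota>) \<union> cf_irregular (IComp_R \<sigma> \<Pi> \<iota>)"
      using that \<open>X \<subseteq> \<sigma>\<close> by (auto simp: IComp_R_def)
    ultimately show ?thesis
      unfolding cf_model_over_vocabulary_def cf_model_within_def gcsp_solution_IComp_R_iff[OF that]
        ranked_def
      by blast
  qed
  have R: "sat (Reg ` X \<union> ranked \<nu>) (R_form \<sigma> \<Pi> \<iota>) \<longleftrightarrow> level_ranking \<iota> \<Pi> X (\<lambda>a. \<nu> (LR a))"
    for \<nu>
  proof -
    have mem: "Reg -` (Reg ` X \<union> ranked \<nu>) = X"
      "Reg a \<in> Reg ` X \<union> ranked \<nu> \<longleftrightarrow> a \<in> X"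
      "Irr a b \<in> Reg ` X \<union> ranked \<nu> \<longleftrightarrow> Irr a b \<in> ?Irr \<and> \<nu> (LR a) - 1 \<ge> \<nu> (LR b)" for a b
      by (auto simp: ranked_def)
    have "sat (Reg ` X \<union> ranked \<nu>) (R_form \<sigma> \<Pi> \<iota>) \<longleftrightarrow>
        (\<forall>a\<in>X - \<iota>. \<exists>B\<in>Bodies \<Pi> a. sat X (body_form B) \<and>
           (\<forall>b\<in>set (pos B) - \<iota>. Irr a b \<in> ?Irr \<and> \<nu> (LR a) - 1 \<ge> \<nu> (LR b)))"
      unfolding sat_R_form[OF fin] mem using \<open>X \<subseteq> \<sigma>\<close> by blast
    also have "\<dots> \<longleftrightarrow> level_ranking \<iota> \<Pi> X (\<lambda>a. \<nu> (LR a))"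
    proof -
      \<comment> \<open>Makes the membership in \<open>?Irr\<close> redundant, leaving only the
        inequality.\<close>
      have "Irr a b \<in> ?Irr" if "a \<in> X - \<iota>" "B \<in> Bodies \<Pi> a" "b \<in> set (pos B) - \<iota>" for a b B
        using Irr_in_irregular_atoms[OF fin _ that(2,3)] that(1) \<open>X \<subseteq> \<sigma>\<close> by blast
      then show ?thesis
        unfolding level_ranking_def by (intro ball_cong bex_cong conj_cong refl) simp
    qed
    finally show ?thesis .
  qed
  \<comment> \<open>A ranking supplies a true body for each atom of \<open>X\<close> outside
    \<open>\<iota>\<close>, so the completion implications hold and only the rules remain.\<close>
  have IComp: "sat X (IComp \<sigma> \<Pi> \<iota>) \<longleftrightarrow> satisfies_program X \<Pi>" if "level_ranking \<iota> \<Pi> X \<nu>" for \<nu>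
    using that unfolding sat_IComp[OF fin] level_ranking_def by blast
  have "(\<exists>Xi \<subseteq> ?Irr. cf_model_over_vocabulary (IComp_R \<sigma> \<Pi> \<iota>) (Reg ` X \<union> Xi)) \<longleftrightarrow>
      (\<exists>\<nu>. sat X (IComp \<sigma> \<Pi> \<iota>) \<and> sat (Reg ` X \<union> ranked \<nu>) (R_form \<sigma> \<Pi> \<iota>))"
    (is "?L \<longleftrightarrow> ?R")
  proof
    assume ?L
    then obtain Xi where Xi: "Xi \<subseteq> ?Irr" "cf_model_over_vocabulary (IComp_R \<sigma> \<Pi> \<iota>) (Reg ` X \<union> Xi)"
      by blast
    then obtain \<nu> where "Xi = ranked \<nu>"
      using model by blast
    with Xi model[OF Xi(1)] show ?R
      by blast
  next
    assume ?R
    then obtain \<nu> where "sat X (IComp \<sigma> \<Pi> \<iota>)" "sat (Reg ` X \<union> ranked \<nu>) (R_form \<sigma> \<Pi> \<iota>)"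
      by blast
    moreover have "ranked \<nu> \<subseteq> ?Irr"
      by (auto simp: ranked_def)
    ultimately show ?L
      using model[of "ranked \<nu>"] by blast
  qed
  also have "\<dots> \<longleftrightarrow> (\<exists>\<nu>. satisfies_program X \<Pi> \<and> level_ranking \<iota> \<Pi> X (\<lambda>a. \<nu> (LR a)))"
    unfolding R using IComp by blast
  also have "\<dots> \<longleftrightarrow> satisfies_program X \<Pi> \<and> (\<exists>\<nu>. level_ranking \<iota> \<Pi> X \<nu>)"
  proof -
    \<comment> \<open>Valuations act on variables \<open>LR a\<close> and rankings on atoms; the
      case expression undoes the constructor.\<close>
    have "\<exists>\<mu>. level_ranking \<iota> \<Pi> X (\<lambda>a. \<mu> (LR a))" if "level_ranking \<iota> \<Pi> X \<nu>" for \<nu>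
      using that by (intro exI[of _ "\<lambda>v. case v of LR a \<Rightarrow> \<nu> a"]) simp
    then show ?thesis
      by blast
  qed
  finally show ?thesis .
qed

theorem theorem9:
  fixes \<sigma> \<iota> X :: "'a set" and \<Pi> :: "'a rule set"
  assumes "finite \<sigma>" and "program_over \<sigma> \<Pi>"
    and "\<iota> \<subseteq> \<sigma>" and "hd_atoms \<Pi> \<inter> \<iota> = {}"
    and "X \<subseteq> \<sigma>"
  shows "(input_answer_set \<sigma> \<Pi> \<iota> X \<longleftrightarrow>
            (\<exists>Xi \<subseteq> irregular_atoms \<sigma> \<Pi> \<iota>.
               cf_model_over_vocabulary (IComp_R \<sigma> \<Pi> \<iota>) (Reg ` X \<union> Xi))) \<and>
         (Reg ` X \<subseteq> atoms (cf_form (IComp_R \<sigma> \<Pi> \<iota>)) \<longrightarrow>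
           (input_answer_set \<sigma> \<Pi> \<iota> X \<longleftrightarrow>
              (\<exists>Xi \<subseteq> irregular_atoms \<sigma> \<Pi> \<iota>.
                 cf_model (IComp_R \<sigma> \<Pi> \<iota>) (Reg ` X \<union> Xi))))"
proof -
  let ?C = "IComp_R \<sigma> \<Pi> \<iota>"
  have fin: "finite \<Pi>" "finite X"
    using assms by (auto simp: program_over_def finite_subset)
  have main: "input_answer_set \<sigma> \<Pi> \<iota> X \<longleftrightarrow>
      (\<exists>Xi \<subseteq> irregular_atoms \<sigma> \<Pi> \<iota>. cf_model_over_vocabulary ?C (Reg ` X \<union> Xi))"
    unfolding input_answer_set_def answer_set_iff_level_ranking[OF fin(2)]
      cf_model_over_vocabulary_iff_level_ranking[OF assms(1) fin(1) assms(5)]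
    using assms(5) by blast
  have "cf_model ?C (Reg ` X \<union> Xi) \<longleftrightarrow> cf_model_over_vocabulary ?C (Reg ` X \<union> Xi)"
    if "Reg ` X \<subseteq> atoms (cf_form ?C)" "Xi \<subseteq> irregular_atoms \<sigma> \<Pi> \<iota>" for Xi
  proof -
    have "Reg ` X \<union> Xi \<subseteq> atoms (cf_form ?C)"
      using that irregular_atoms_subset by (fastforce simp: IComp_R_def)
    moreover have "Reg ` X \<union> Xi \<subseteq> cf_regular ?C \<union> cf_irregular ?C"
      using that(2) assms(5) by (auto simp: IComp_R_def)
    ultimately show ?thesis
      by (simp add: cf_model_def cf_model_over_vocabulary_def cf_model_within_def)
  qed
  with main show ?thesis
    by (metis (no_types, lifting))
qed

end
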